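(* Let $L$ be a $\kappa$-frame. A congruence $C$ on $L$ is spatial if and only if it is an intersection of prime elements of the frame $\mathbb{C}L$ of congruences on $L$.
   Context: Here $\kappa$ is either an infinite regular cardinal or the symbol $\infty$. A $\kappa$-set is a set of cardinality less than $\kappa$ (any set if $\kappa=\infty$). A $\kappa$-frame is a bounded distributive lattice with joins of all $\kappa$-sets, over which binary meets distribute; for $\kappa=\infty$ this is a frame. Homomorphisms preserve finite meets and $\kappa$-joins. A congruence on $L$ is an equivalence relation on $L$ closed under finite meets and $\kappa$-joins in $L\times L$; congruences are ordered by inclusion and form a frame $\mathbb{C}L$ (with meets given by intersection; the empty intersection is $L\times L$). An element $p$ of a frame is prime if $p\neq1$ and $a\wedge b\le p$ implies $a\le p$ or $b\le p$. A $\kappa$-space is a set $X$ with a sub-$\kappa$-frame $\tau$ of the power set $2^X$. For a $\kappa$-frame $M$, its spectrum $\Sigma M$ is the set $\mathrm{Hom}(M,\mathbf{2})$ of $\kappa$-frame homomorphisms to the two-element frame $\mathbf{2}$, with $\tau=\{U_a\mid a\in M\}$, $U_a=\{f\mid f(a)=1\}$. $M$ is spatial if the surjection $\sigma_M:M\to\tau$, $a\mapsto U_a$, is an isomorphism. A congruence $C$ on $L$ is called spatial if the quotient $\kappa$-frame $L/C$ is spatial. *)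

theory Defs
  imports "HOL-Algebra.Lattice"
begin

unbundle cardinal_syntax

datatype 'k size_bound = Cardinal "'k rel" | Unbounded

text \<open>\<open>Unbounded\<close> is the symbol \<open>\<infinity>\<close>. A cardinal is represented, as in the library, by
  a well-order on its field that is minimal among those of the same cardinality.\<close>

fun regular_bound :: "'k size_bound \<Rightarrow> bool" where
  "regular_bound (Cardinal r) \<longleftrightarrow> Cinfinite r \<and> regularCard r"
| "regular_bound Unbounded \<longleftrightarrow> True"

fun kset :: "'k size_bound \<Rightarrow> 'a set \<Rightarrow> bool" where
  "kset (Cardinal r) A \<longleftrightarrow> |A| <o r"
| "kset Unbounded A \<longleftrightarrow> True"

locale kframe = bounded_lattice L for L (structure) +
  fixes \<kappa> :: "'k size_bound"
  assumes meet_distrib_join: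
      "\<lbrakk>x \<in> carrier L; y \<in> carrier L; z \<in> carrier L\<rbrakk>
        \<Longrightarrow> x \<sqinter> (y \<squnion> z) = (x \<sqinter> y) \<squnion> (x \<sqinter> z)"
    and ksup_exists: "\<lbrakk>A \<subseteq> carrier L; kset \<kappa> A\<rbrakk> \<Longrightarrow> \<exists>s. is_lub L s A"
    and meet_distrib_ksup:
      "\<lbrakk>x \<in> carrier L; A \<subseteq> carrier L; kset \<kappa> A\<rbrakk>
        \<Longrightarrow> x \<sqinter> (\<Squnion>A) = \<Squnion>((\<lambda>a. x \<sqinter> a) ` A)"

text \<open>Homomorphisms are extensional functions, so that \<open>kframe_Hom \<kappa> M N\<close> has exactly one element
  for each homomorphism. The empty meet is the top element and the empty join the bottom element.\<close>

definition kframe_Hom ::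
    "'k size_bound \<Rightarrow> ('a, 'c) gorder_scheme \<Rightarrow> ('b, 'd) gorder_scheme \<Rightarrow> ('a \<Rightarrow> 'b) set" where
  "kframe_Hom \<kappa> M N =
    {f \<in> carrier M \<rightarrow>\<^sub>E carrier N.
      (\<forall>F. finite F \<and> F \<subseteq> carrier M \<longrightarrow> f (\<Sqinter>\<^bsub>M\<^esub>F) = \<Sqinter>\<^bsub>N\<^esub>(f ` F)) \<and>
      (\<forall>A. kset \<kappa> A \<and> A \<subseteq> carrier M \<longrightarrow> f (\<Squnion>\<^bsub>M\<^esub>A) = \<Squnion>\<^bsub>N\<^esub>(f ` A))}"

definition kframe_iso ::
    "'k size_bound \<Rightarrow> ('a, 'c) gorder_scheme \<Rightarrow> ('b, 'd) gorder_scheme \<Rightarrow> ('a \<Rightarrow> 'b) \<Rightarrow> bool" where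
  "kframe_iso \<kappa> M N f \<longleftrightarrow>
    f \<in> kframe_Hom \<kappa> M N \<and>
    (\<exists>g \<in> kframe_Hom \<kappa> N M.
      (\<forall>x \<in> carrier M. g (f x) = x) \<and> (\<forall>y \<in> carrier N. f (g y) = y))"

definition two_frame :: "bool gorder" where
  "two_frame = \<lparr>carrier = UNIV, eq = (=), le = (\<le>)\<rparr>"

definition inclusion_order :: "'a set set \<Rightarrow> 'a set gorder" where
  "inclusion_order \<A> = \<lparr>carrier = \<A>, eq = (=), le = (\<subseteq>)\<rparr>"

definition spectrum :: "'k size_bound \<Rightarrow> ('a, 'c) gorder_scheme \<Rightarrow> ('a \<Rightarrow> bool) set" where
  "spectrum \<kappa> M = kframe_Hom \<kappa> M two_frame"

definition spectrum_map ::
    "'k size_bound \<Rightarrow> ('a, 'c) gorder_scheme \<Rightarrow> 'a \<Rightarrow> ('a \<Rightarrow> bool) set" where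
  "spectrum_map \<kappa> M = (\<lambda>a \<in> carrier M. {f \<in> spectrum \<kappa> M. f a = True})"

definition spectrum_opens ::
    "'k size_bound \<Rightarrow> ('a, 'c) gorder_scheme \<Rightarrow> ('a \<Rightarrow> bool) set set" where
  "spectrum_opens \<kappa> M = spectrum_map \<kappa> M ` carrier M"

definition spatial :: "'k size_bound \<Rightarrow> ('a, 'c) gorder_scheme \<Rightarrow> bool" where
  "spatial \<kappa> M \<longleftrightarrow>
    kframe_iso \<kappa> M (inclusion_order (spectrum_opens \<kappa> M)) (spectrum_map \<kappa> M)"

text \<open>The operations of \<open>L \<times> L\<close> are computed componentwise.\<close>

definition kframe_congruence ::
    "'k size_bound \<Rightarrow> ('a, 'c) gorder_scheme \<Rightarrow> 'a rel \<Rightarrow> bool" where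
  "kframe_congruence \<kappa> L C \<longleftrightarrow>
    equiv (carrier L) C \<and>
    (\<forall>F. finite F \<and> F \<subseteq> C \<longrightarrow> (\<Sqinter>\<^bsub>L\<^esub>(fst ` F), \<Sqinter>\<^bsub>L\<^esub>(snd ` F)) \<in> C) \<and>
    (\<forall>S. kset \<kappa> S \<and> S \<subseteq> C \<longrightarrow> (\<Squnion>\<^bsub>L\<^esub>(fst ` S), \<Squnion>\<^bsub>L\<^esub>(snd ` S)) \<in> C)"

definition congruence_frame ::
    "'k size_bound \<Rightarrow> ('a, 'c) gorder_scheme \<Rightarrow> 'a rel gorder" where
  "congruence_frame \<kappa> L = inclusion_order {C. kframe_congruence \<kappa> L C}"

text \<open>The order of \<open>L / C\<close> is the one induced by its meet \<open>[x] \<and> [y] = [x \<and> y]\<close>: one has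
  \<open>X \<le> Y\<close> iff \<open>X \<and> Y = X\<close>. For a congruence this does not depend on the representatives.\<close>

definition quotient_kframe :: "('a, 'c) gorder_scheme \<Rightarrow> 'a rel \<Rightarrow> 'a set gorder" where
  "quotient_kframe L C =
    \<lparr>carrier = carrier L // C, eq = (=),
     le = (\<lambda>X Y. \<exists>x \<in> X. \<exists>y \<in> Y. C `` {x \<sqinter>\<^bsub>L\<^esub> y} = X)\<rparr>"

definition spatial_congruence ::
    "'k size_bound \<Rightarrow> ('a, 'c) gorder_scheme \<Rightarrow> 'a rel \<Rightarrow> bool" where
  "spatial_congruence \<kappa> L C \<longleftrightarrow> spatial \<kappa> (quotient_kframe L C)"

definition prime_element :: "('a, 'c) gorder_scheme \<Rightarrow> 'a \<Rightarrow> bool" where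
  "prime_element F p \<longleftrightarrow>
    p \<in> carrier F \<and> p \<noteq> \<top>\<^bsub>F\<^esub> \<and>
    (\<forall>a \<in> carrier F. \<forall>b \<in> carrier F.
      a \<sqinter>\<^bsub>F\<^esub> b \<sqsubseteq>\<^bsub>F\<^esub> p \<longrightarrow> a \<sqsubseteq>\<^bsub>F\<^esub> p \<or> b \<sqsubseteq>\<^bsub>F\<^esub> p)"

end

theory Submission
  imports Defs
begin

text \<open>
  The prime congruences are exactly the kernels of the points of \<open>L\<close>, that is, of the homomorphisms
  \<open>L \<rightarrow> 2\<close>; the theorem is then a reformulation of the fact that a \<open>\<kappa>\<close>-frame is spatial iff its points
  separate its elements.

  \<^item> For every \<open>a\<close>, the relations \<open>a \<and> x = a \<and> y\<close> and \<open>x \<or> a = y \<or> a\<close> are congruences that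
    meet in the diagonal (\<open>open_Int_closed\<close>). A prime congruence \<open>P\<close> therefore contains one of
    them, so it identifies \<open>a\<close> with \<open>1\<close> or with \<open>0\<close>. Since \<open>P\<close> is proper, \<open>L / P\<close> has exactly two
    elements, and \<open>P\<close> is the kernel of the quotient map (\<open>prime_congruence_is_point_kernel\<close>).

  \<^item> Conversely, the kernel of a point \<open>f\<close> is prime (\<open>prime_point_kernel\<close>): from pairs in \<open>A\<close> and in
    \<open>B\<close> that \<open>f\<close> separates, a lattice term produces one pair in \<open>A \<inter> B\<close> that \<open>f\<close> separates.

  \<^item> Points of \<open>L / C\<close> correspond to points of \<open>L\<close> whose kernel contains \<open>C\<close>. So \<open>L / C\<close> is spatial
    iff \<open>C\<close> contains every pair that lies in all point kernels above \<open>C\<close>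
    (\<open>spatial_congruence_iff\<close>).

  As \<open>\<kappa>\<close> is infinite, finite sets are \<open>\<kappa>\<close>-sets, so that congruences are closed under the binary joins
  in this lattice term and points preserve them.
\<close>

section \<open>Orders, two-valued points and small sets\<close>

lemma (in partial_order) sup_eqI: "is_lub L s A \<Longrightarrow> \<Squnion>A = s"
  unfolding sup_def by (rule some_equality) (auto intro: least_unique)

lemma (in partial_order) inf_eqI: "is_glb L s A \<Longrightarrow> \<Sqinter>A = s"
  unfolding inf_def by (rule some_equality) (auto intro: greatest_unique)

lemma partial_order_inclusion_order: "partial_order (inclusion_order \<A>)"
  by unfold_locales (auto simp: inclusion_order_def)

lemma two_frame_Inf: "\<Sqinter>\<^bsub>two_frame\<^esub>B \<longleftrightarrow> (\<forall>b\<in>B. b)"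
  and two_frame_Sup: "\<Squnion>\<^bsub>two_frame\<^esub>B \<longleftrightarrow> (\<exists>b\<in>B. b)"
proof -
  interpret partial_order two_frame
    by unfold_locales (auto simp: two_frame_def)
  show "\<Sqinter>\<^bsub>two_frame\<^esub>B \<longleftrightarrow> (\<forall>b\<in>B. b)"
    by (rule inf_eqI) (auto simp: greatest_def Lower_def two_frame_def)
  show "\<Squnion>\<^bsub>two_frame\<^esub>B \<longleftrightarrow> (\<exists>b\<in>B. b)"
    by (rule sup_eqI) (auto simp: least_def Upper_def two_frame_def)
qed

text \<open>A point sends a finite meet to a conjunction and a \<open>\<kappa>\<close>-join to a disjunction.\<close>

lemma spectrum_iff:
  "f \<in> spectrum \<kappa> M \<longleftrightarrow>
    f \<in> extensional (carrier M) \<and>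
    (\<forall>F. finite F \<and> F \<subseteq> carrier M \<longrightarrow> f (\<Sqinter>\<^bsub>M\<^esub>F) = (\<forall>a\<in>F. f a)) \<and>
    (\<forall>A. kset \<kappa> A \<and> A \<subseteq> carrier M \<longrightarrow> f (\<Squnion>\<^bsub>M\<^esub>A) = (\<exists>a\<in>A. f a))"
proof -
  have "carrier M \<rightarrow>\<^sub>E carrier two_frame = extensional (carrier M)"
    by (auto simp: two_frame_def PiE_def)
  then show ?thesis
    unfolding spectrum_def kframe_Hom_def by (simp add: two_frame_Inf two_frame_Sup)
qed

lemma kset_image: "kset \<kappa> A \<Longrightarrow> kset \<kappa> (f ` A)"
  by (cases \<kappa>) (auto intro: ordLeq_ordLess_trans[OF card_of_image])

lemma kset_finite: "regular_bound \<kappa> \<Longrightarrow> finite A \<Longrightarrow> kset \<kappa> A"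
proof (cases \<kappa>)
  case (Cardinal r)
  assume "regular_bound \<kappa>" "finite A"
  with Cardinal have "Well_order r" "infinite (Field r)" "finite (Field |A| )"
    by (auto simp: cinfinite_def Field_card_of card_order_on_well_order_on)
  then show ?thesis
    using Cardinal finite_ordLess_infinite[OF card_of_Well_order] by simp
qed simp

lemma kset_subset_image:
  assumes "kset \<kappa> B" "B \<subseteq> q ` X"
  shows "\<exists>A\<subseteq>X. kset \<kappa> A \<and> B = q ` A"
proof -
  obtain A where A: "A \<subseteq> X" "inj_on q A" "B = q ` A"
    using assms by (meson subset_image_inj)
  then have "A = inv_into A q ` B" by simp
  then have "kset \<kappa> A" using kset_image[OF assms(1)] by metis
  with A show ?thesis by blast
qed

section \<open>Calculus in a \<open>\<kappa>\<close>-frame\<close>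

locale regular_kframe = kframe +
  assumes regular: "regular_bound \<kappa>"
begin

lemma finite_inf_is_glb:
  assumes "finite F" "F \<subseteq> carrier L"
  shows "is_glb L (\<Sqinter>F) F"
proof (cases "F = {}")
  case True
  have "is_glb L \<top> {}" using top_greatest by (simp add: Lower_empty)
  with True show ?thesis using inf_eqI by metis
qed (use assms finite_inf_greatest in auto)

lemma ksup_is_lub:
  assumes "kset \<kappa> A" "A \<subseteq> carrier L"
  shows "is_lub L (\<Squnion>A) A"
  using ksup_exists[OF assms(2,1)] sup_eqI by metis

lemma inf_closed [simp]: "finite F \<Longrightarrow> F \<subseteq> carrier L \<Longrightarrow> \<Sqinter>F \<in> carrier L"
  using finite_inf_is_glb by (rule greatest_closed)

lemma inf_lower: "finite F \<Longrightarrow> F \<subseteq> carrier L \<Longrightarrow> a \<in> F \<Longrightarrow> \<Sqinter>F \<sqsubseteq> a"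
  using finite_inf_is_glb greatest_Lower_below by metis

lemma ksup_closed [simp]: "kset \<kappa> A \<Longrightarrow> A \<subseteq> carrier L \<Longrightarrow> \<Squnion>A \<in> carrier L"
  using ksup_is_lub by (rule least_closed)

lemma ksup_upper: "kset \<kappa> A \<Longrightarrow> A \<subseteq> carrier L \<Longrightarrow> a \<in> A \<Longrightarrow> a \<sqsubseteq> \<Squnion>A"
  using ksup_is_lub least_Upper_above by metis

lemma ksup_least:
  "kset \<kappa> A \<Longrightarrow> A \<subseteq> carrier L \<Longrightarrow> b \<in> carrier L \<Longrightarrow> (\<And>a. a \<in> A \<Longrightarrow> a \<sqsubseteq> b) \<Longrightarrow> \<Squnion>A \<sqsubseteq> b"
  by (meson ksup_is_lub least_le Upper_memI)

lemma inf_greatest: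
  "finite F \<Longrightarrow> F \<subseteq> carrier L \<Longrightarrow> b \<in> carrier L \<Longrightarrow> (\<And>a. a \<in> F \<Longrightarrow> b \<sqsubseteq> a) \<Longrightarrow> b \<sqsubseteq> \<Sqinter>F"
  by (meson finite_inf_is_glb greatest_le Lower_memI)

lemma inf_empty: "\<Sqinter>{} = \<top>"
  by (rule inf_eqI) (use top_greatest in \<open>simp add: Lower_empty\<close>)

lemma inf_insert:
  assumes "finite F" "F \<subseteq> carrier L" "a \<in> carrier L"
  shows "\<Sqinter>(insert a F) = a \<sqinter> \<Sqinter>F"
proof (rule le_antisym)
  show "\<Sqinter>(insert a F) \<sqsubseteq> a \<sqinter> \<Sqinter>F"
    using assms by (intro meet_le inf_greatest inf_closed) (auto intro: inf_lower)
  have *: "a \<sqinter> \<Sqinter>F \<sqsubseteq> b" if "b \<in> F" for b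
  proof (rule le_trans[of _ "\<Sqinter>F"])
    show "a \<sqinter> \<Sqinter>F \<sqsubseteq> \<Sqinter>F" "\<Sqinter>F \<sqsubseteq> b"
      using assms that by (auto intro: meet_right inf_lower)
  qed (use assms that in auto)
  show "a \<sqinter> \<Sqinter>F \<sqsubseteq> \<Sqinter>(insert a F)"
    using assms * by (intro inf_greatest) (auto intro: meet_left)
qed (use assms in auto)

lemma meet_absorb: "x \<in> carrier L \<Longrightarrow> y \<in> carrier L \<Longrightarrow> x \<sqsubseteq> y \<Longrightarrow> x \<sqinter> y = x"
  using le_iff_join by metis

lemma join_absorb: "x \<in> carrier L \<Longrightarrow> y \<in> carrier L \<Longrightarrow> x \<sqsubseteq> y \<Longrightarrow> x \<squnion> y = y"
  using le_iff_meet by metis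

lemma join_distrib_meet:
  assumes "x \<in> carrier L" "y \<in> carrier L" "a \<in> carrier L"
  shows "(x \<sqinter> y) \<squnion> a = (x \<squnion> a) \<sqinter> (y \<squnion> a)"
proof -
  have "(x \<squnion> a) \<sqinter> (y \<squnion> a) = ((x \<squnion> a) \<sqinter> y) \<squnion> ((x \<squnion> a) \<sqinter> a)"
    using assms by (simp add: meet_distrib_join)
  also have "(x \<squnion> a) \<sqinter> a = a"
    using assms meet_absorb[of a "x \<squnion> a"] by (simp add: meet_comm join_right)
  also have "(x \<squnion> a) \<sqinter> y = (x \<sqinter> y) \<squnion> (a \<sqinter> y)"
    using assms meet_distrib_join[of y x a] by (simp add: meet_comm)
  also have "(x \<sqinter> y) \<squnion> (a \<sqinter> y) \<squnion> a = (x \<sqinter> y) \<squnion> ((a \<sqinter> y) \<squnion> a)"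
    using assms weak_join_assoc eq_is_equal by simp
  also have "(a \<sqinter> y) \<squnion> a = a"
    using assms by (intro join_absorb) (auto intro: meet_left)
  finally show ?thesis by simp
qed

text \<open>A reflexive relation closed under binary meets is closed under finite meets, by induction.\<close>

lemma kframe_congruenceI:
  assumes "equiv (carrier L) C"
    and meet: "\<And>x y u v. (x, y) \<in> C \<Longrightarrow> (u, v) \<in> C \<Longrightarrow> (x \<sqinter> u, y \<sqinter> v) \<in> C"
    and sup: "\<And>S. kset \<kappa> S \<Longrightarrow> S \<subseteq> C \<Longrightarrow> (\<Squnion>(fst ` S), \<Squnion>(snd ` S)) \<in> C"
  shows "kframe_congruence \<kappa> L C"
proof -
  have sub: "C \<subseteq> carrier L \<times> carrier L" and refl: "refl_on (carrier L) C"
    using assms(1) by (auto simp: equiv_def)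
  have "(\<Sqinter>(fst ` F), \<Sqinter>(snd ` F)) \<in> C" if "finite F" "F \<subseteq> C" for F
    using that
  proof induction
    case empty
    show ?case using refl top_closed by (simp add: inf_empty refl_on_def)
  next
    case (insert p F)
    then have "fst ` F \<subseteq> carrier L" "snd ` F \<subseteq> carrier L" "fst p \<in> carrier L" "snd p \<in> carrier L"
      using sub by auto
    with insert show ?case by (simp add: inf_insert meet)
  qed
  with assms(1) sup show ?thesis unfolding kframe_congruence_def by blast
qed

section \<open>Points\<close>

lemma spectrum_meet:
  assumes "f \<in> spectrum \<kappa> L" "x \<in> carrier L" "y \<in> carrier L"
  shows "f (x \<sqinter> y) \<longleftrightarrow> f x \<and> f y"
  using assms unfolding spectrum_iff meet_def by auto

lemma spectrum_join:
  assumes "f \<in> spectrum \<kappa> L" "x \<in> carrier L" "y \<in> carrier L"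
  shows "f (x \<squnion> y) \<longleftrightarrow> f x \<or> f y"
proof -
  have "kset \<kappa> {x, y}" using regular by (simp add: kset_finite)
  then show ?thesis using assms unfolding spectrum_iff join_def by auto
qed

text \<open>As for any algebraic structure, the inverse of a bijective homomorphism is a homomorphism.\<close>

lemma bij_Hom_iso:
  assumes h: "h \<in> kframe_Hom \<kappa> L N" and bij: "bij_betw h (carrier L) (carrier N)"
  shows "kframe_iso \<kappa> L N h"
proof -
  define g where "g = restrict (inv_into (carrier L) h) (carrier N)"
  have gh: "g (h x) = x" if "x \<in> carrier L" for x
    proof -
    have "inj_on h (carrier L)" "h x \<in> carrier N"
      using that bij bij_betw_imp_inj_on bij_betw_apply by metis+
    then show ?thesis using that by (simp add: g_def)
  qed
  have hg: "h (g y) = y" "g y \<in> carrier L" if "y \<in> carrier N" for y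
    using that bij unfolding g_def by (auto simp: bij_betw_def f_inv_into_f inv_into_into)
  have himg: "h ` g ` F = F" and gimg: "g ` F \<subseteq> carrier L" if "F \<subseteq> carrier N" for F
    using that hg by (auto simp: image_image subset_iff)
  have "g (\<Sqinter>\<^bsub>N\<^esub>F) = \<Sqinter>(g ` F)" if F: "finite F" "F \<subseteq> carrier N" for F
  proof -
    have "h (\<Sqinter>(g ` F)) = \<Sqinter>\<^bsub>N\<^esub>(h ` g ` F)"
      using h F gimg[OF F(2)] unfolding kframe_Hom_def by blast
    then show ?thesis using gh[of "\<Sqinter>(g ` F)"] F gimg[OF F(2)] by (simp add: himg)
  qed
  moreover have "g (\<Squnion>\<^bsub>N\<^esub>F) = \<Squnion>(g ` F)" if F: "kset \<kappa> F" "F \<subseteq> carrier N" for F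
  proof -
    have "h (\<Squnion>(g ` F)) = \<Squnion>\<^bsub>N\<^esub>(h ` g ` F)"
      using h F gimg[OF F(2)] kset_image[OF F(1), of g] unfolding kframe_Hom_def by blast
    then show ?thesis
      using gh[of "\<Squnion>(g ` F)"] F gimg[OF F(2)] kset_image[OF F(1), of g] by (simp add: himg)
  qed
  moreover have "g \<in> carrier N \<rightarrow>\<^sub>E carrier L"
    using hg(2) by (intro PiE_I) (auto simp: g_def)
  ultimately have "g \<in> kframe_Hom \<kappa> N L" unfolding kframe_Hom_def by blast
  then show ?thesis unfolding kframe_iso_def using h gh hg(1) by (intro conjI bexI[of _ g]) auto
qed

text \<open>Meets and joins are determined by the order, so an order isomorphism onto any partial order
  preserves them; that the target has these meets and joins comes for free. This spares computing
  them in the lattice of opens of the spectrum.\<close>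

lemma order_iso_Hom:
  assumes "partial_order N" and ext: "h \<in> extensional (carrier L)"
    and bij: "bij_betw h (carrier L) (carrier N)"
    and le: "\<And>x y. x \<in> carrier L \<Longrightarrow> y \<in> carrier L \<Longrightarrow> h x \<sqsubseteq>\<^bsub>N\<^esub> h y \<longleftrightarrow> x \<sqsubseteq> y"
  shows "h \<in> kframe_Hom \<kappa> L N"
proof -
  interpret N: partial_order N by fact
  have N: "carrier N = h ` carrier L" using bij by (simp add: bij_betw_def)
  have "h (\<Sqinter>F) = \<Sqinter>\<^bsub>N\<^esub>(h ` F)" if F: "finite F" "F \<subseteq> carrier L" for F
  proof (rule N.inf_eqI[symmetric])
    show "is_glb N (h (\<Sqinter>F)) (h ` F)"
      unfolding greatest_def
    proof (intro conjI ballI)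
      have "h (\<Sqinter>F) \<sqsubseteq>\<^bsub>N\<^esub> h a" if "a \<in> F" for a
        using F that by (subst le) (auto intro: inf_lower)
      then show "h (\<Sqinter>F) \<in> Lower N (h ` F)"
        using inf_closed[OF F] by (auto simp: Lower_def N)
      fix z assume "z \<in> Lower N (h ` F)"
      then have "z \<in> h ` carrier L" and z: "\<And>a. a \<in> F \<Longrightarrow> z \<sqsubseteq>\<^bsub>N\<^esub> h a"
        using F(2) unfolding Lower_def N by blast+
      then obtain x where x: "x \<in> carrier L" "z = h x" by blast
      have lower: "h x \<sqsubseteq>\<^bsub>N\<^esub> h a" if "a \<in> F" for a using z[OF that] x by simp
      have "x \<sqsubseteq> \<Sqinter>F" using F x lower by (intro inf_greatest) (auto simp flip: le)
      then show "z \<sqsubseteq>\<^bsub>N\<^esub> h (\<Sqinter>F)" using F x by (simp add: le)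
    qed (auto simp: Lower_def)
  qed
  moreover have "h (\<Squnion>A) = \<Squnion>\<^bsub>N\<^esub>(h ` A)" if A: "kset \<kappa> A" "A \<subseteq> carrier L" for A
  proof (rule N.sup_eqI[symmetric])
    show "is_lub N (h (\<Squnion>A)) (h ` A)"
      unfolding least_def
    proof (intro conjI ballI)
      have "h a \<sqsubseteq>\<^bsub>N\<^esub> h (\<Squnion>A)" if "a \<in> A" for a
        using A that by (subst le) (auto intro: ksup_upper)
      then show "h (\<Squnion>A) \<in> Upper N (h ` A)"
        using ksup_closed[OF A] by (auto simp: Upper_def N)
      fix z assume "z \<in> Upper N (h ` A)"
      then have "z \<in> h ` carrier L" and z: "\<And>a. a \<in> A \<Longrightarrow> h a \<sqsubseteq>\<^bsub>N\<^esub> z"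
        using A(2) unfolding Upper_def N by blast+
      then obtain x where x: "x \<in> carrier L" "z = h x" by blast
      have upper: "h a \<sqsubseteq>\<^bsub>N\<^esub> h x" if "a \<in> A" for a using z[OF that] x by simp
      have "\<Squnion>A \<sqsubseteq> x" using A x upper by (intro ksup_least) (auto simp flip: le)
      then show "h (\<Squnion>A) \<sqsubseteq>\<^bsub>N\<^esub> z" using A x by (simp add: le)
    qed (auto simp: Upper_def)
  qed
  ultimately show ?thesis using ext N unfolding kframe_Hom_def by (auto simp: PiE_iff)
qed

text \<open>Injectivity of \<open>a \<mapsto> U\<^sub>a\<close> is all that matters: the map is onto the opens by definition, and
  because \<open>U\<^bsub>a \<and> b\<^esub> = U\<^sub>a \<inter> U\<^sub>b\<close> an injective \<open>U\<close> also reflects the order.\<close>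

lemma spatial_iff_points_separate:
  "spatial \<kappa> L \<longleftrightarrow>
    (\<forall>x\<in>carrier L. \<forall>y\<in>carrier L. (\<forall>f\<in>spectrum \<kappa> L. f x = f y) \<longrightarrow> x = y)"
    (is "_ \<longleftrightarrow> ?sep")
proof -
  let ?U = "spectrum_map \<kappa> L"
  have U: "?U x = {f \<in> spectrum \<kappa> L. f x}" if "x \<in> carrier L" for x
    using that by (simp add: spectrum_map_def)
  have "?U x = ?U y \<longleftrightarrow> (\<forall>f\<in>spectrum \<kappa> L. f x = f y)" if "x \<in> carrier L" "y \<in> carrier L" for x y
  proof
    assume eq: "?U x = ?U y"
    show "\<forall>f\<in>spectrum \<kappa> L. f x = f y"
    proof
      fix f assume f: "f \<in> spectrum \<kappa> L"
      have "f \<in> ?U x \<longleftrightarrow> f \<in> ?U y" using eq by simp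
      then show "f x = f y" using that f by (simp add: U)
    qed
  next
    assume eq: "\<forall>f\<in>spectrum \<kappa> L. f x = f y"
    show "?U x = ?U y"
      unfolding U[OF that(1)] U[OF that(2)]
      by (rule Collect_cong, rule conj_cong[OF HOL.refl], erule bspec[OF eq])
  qed
  then have "?sep \<longleftrightarrow> inj_on ?U (carrier L)"
    unfolding inj_on_def by (simp cong: ball_cong)
  moreover have "inj_on ?U (carrier L)" if "spatial \<kappa> L"
  proof -
    have "\<exists>g. \<forall>x\<in>carrier L. g (?U x) = x"
      using that unfolding spatial_def kframe_iso_def by (elim conjE bexE) (rule exI)
    then obtain g where "\<forall>x\<in>carrier L. g (?U x) = x" ..
    then show ?thesis by (intro inj_on_inverseI[of _ g ?U]) (rule bspec)
  qed
  moreover have "spatial \<kappa> L" if inj: "inj_on ?U (carrier L)"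
  proof -
    let ?N = "inclusion_order (spectrum_opens \<kappa> L)"
    have bij: "bij_betw ?U (carrier L) (carrier ?N)"
      using inj by (simp add: bij_betw_def inclusion_order_def spectrum_opens_def)
    have "?U \<in> kframe_Hom \<kappa> L ?N"
    proof (rule order_iso_Hom[OF partial_order_inclusion_order _ bij])
      fix x y assume xy: "x \<in> carrier L" "y \<in> carrier L"
      have "?U (x \<sqinter> y) = ?U x \<inter> ?U y"
        using xy by (auto simp: U spectrum_meet)
      then have "?U x \<subseteq> ?U y \<longleftrightarrow> ?U (x \<sqinter> y) = ?U x" by blast
      also have "\<dots> \<longleftrightarrow> x \<sqinter> y = x"
        using inj xy by (simp add: inj_on_eq_iff)
      also have "\<dots> \<longleftrightarrow> x \<sqsubseteq> y" using xy le_iff_join by metis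
      finally show "?U x \<sqsubseteq>\<^bsub>?N\<^esub> ?U y \<longleftrightarrow> x \<sqsubseteq> y" by (simp add: inclusion_order_def)
    qed (simp add: spectrum_map_def)
    then show ?thesis unfolding spatial_def using bij by (rule bij_Hom_iso)
  qed
  ultimately show ?thesis by blast
qed

end

section \<open>Quotients\<close>

locale kframe_with_congruence = regular_kframe +
  fixes C
  assumes congruence: "kframe_congruence \<kappa> L C"
begin

lemma C_equiv: "equiv (carrier L) C"
  using congruence by (simp add: kframe_congruence_def)

lemma C_closed: "(x, y) \<in> C \<Longrightarrow> x \<in> carrier L \<and> y \<in> carrier L"
  using C_equiv by (auto simp: equiv_def)

lemma C_refl: "x \<in> carrier L \<Longrightarrow> (x, x) \<in> C"
  using C_equiv by (auto simp: equiv_def refl_on_def)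

lemma C_sym: "(x, y) \<in> C \<Longrightarrow> (y, x) \<in> C"
  using C_equiv by (auto simp: equiv_def sym_def)

lemma C_trans: "(x, y) \<in> C \<Longrightarrow> (y, z) \<in> C \<Longrightarrow> (x, z) \<in> C"
  using C_equiv by (auto simp: equiv_def trans_def)

lemma C_inf:
  assumes "finite F" "\<And>a. a \<in> F \<Longrightarrow> (g a, h a) \<in> C"
  shows "(\<Sqinter>(g ` F), \<Sqinter>(h ` F)) \<in> C"
proof -
  let ?S = "(\<lambda>a. (g a, h a)) ` F"
  have "finite ?S \<and> ?S \<subseteq> C" using assms by auto
  then have "(\<Sqinter>(fst ` ?S), \<Sqinter>(snd ` ?S)) \<in> C"
    using congruence unfolding kframe_congruence_def by blast
  then show ?thesis by (simp add: image_image)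
qed

lemma C_sup:
  assumes "kset \<kappa> A" "\<And>a. a \<in> A \<Longrightarrow> (g a, h a) \<in> C"
  shows "(\<Squnion>(g ` A), \<Squnion>(h ` A)) \<in> C"
proof -
  let ?S = "(\<lambda>a. (g a, h a)) ` A"
  have "kset \<kappa> ?S \<and> ?S \<subseteq> C" using assms by (auto intro: kset_image)
  then have "(\<Squnion>(fst ` ?S), \<Squnion>(snd ` ?S)) \<in> C"
    using congruence unfolding kframe_congruence_def by blast
  then show ?thesis by (simp add: image_image)
qed

lemma C_meet: "(x, y) \<in> C \<Longrightarrow> (u, v) \<in> C \<Longrightarrow> (x \<sqinter> u, y \<sqinter> v) \<in> C"
  using C_inf[of "{(x, y), (u, v)}" fst snd] by (auto simp: meet_def)

lemma C_join: "(x, y) \<in> C \<Longrightarrow> (u, v) \<in> C \<Longrightarrow> (x \<squnion> u, y \<squnion> v) \<in> C"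
  using C_sup[of "{(x, y), (u, v)}" fst snd] regular by (auto simp: join_def kset_finite)

abbreviation Q where "Q \<equiv> quotient_kframe L C"
abbreviation q where "q x \<equiv> C `` {x}"

lemma carrier_Q: "carrier Q = q ` carrier L"
  by (auto simp: quotient_kframe_def quotient_def)

lemma q_eq_iff: "x \<in> carrier L \<Longrightarrow> y \<in> carrier L \<Longrightarrow> q x = q y \<longleftrightarrow> (x, y) \<in> C"
  using eq_equiv_class_iff[OF C_equiv] .

text \<open>Compatibility of \<open>C\<close> with binary meets makes the order of the quotient independent of the
  chosen representatives.\<close>

lemma le_Q_iff:
  assumes "x \<in> carrier L" "y \<in> carrier L"
  shows "q x \<sqsubseteq>\<^bsub>Q\<^esub> q y \<longleftrightarrow> (x \<sqinter> y, x) \<in> C"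
proof
  assume "q x \<sqsubseteq>\<^bsub>Q\<^esub> q y"
  then obtain x' y' where *: "(x, x') \<in> C" "(y, y') \<in> C" "q (x' \<sqinter> y') = q x"
    by (auto simp: quotient_kframe_def)
  then have "(x' \<sqinter> y', x) \<in> C" using assms C_closed by (subst (asm) q_eq_iff) auto
  with * show "(x \<sqinter> y, x) \<in> C" using C_meet C_trans by blast
next
  assume "(x \<sqinter> y, x) \<in> C"
  then have "q (x \<sqinter> y) = q x" using assms by (simp add: q_eq_iff)
  moreover have "x \<in> q x" "y \<in> q y" using assms C_refl by auto
  ultimately show "q x \<sqsubseteq>\<^bsub>Q\<^esub> q y" by (auto simp: quotient_kframe_def)
qed

lemma q_mono: "x \<in> carrier L \<Longrightarrow> y \<in> carrier L \<Longrightarrow> x \<sqsubseteq> y \<Longrightarrow> q x \<sqsubseteq>\<^bsub>Q\<^esub> q y"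
  by (simp add: le_Q_iff meet_absorb C_refl)

lemma partial_order_Q: "partial_order Q"
proof
  show "(.=\<^bsub>Q\<^esub>) = (=)" by (simp add: quotient_kframe_def)
  fix X assume "X \<in> carrier Q"
  then show "X \<sqsubseteq>\<^bsub>Q\<^esub> X" by (auto simp: carrier_Q intro: q_mono)
next
  fix X Y assume "X \<sqsubseteq>\<^bsub>Q\<^esub> Y" "Y \<sqsubseteq>\<^bsub>Q\<^esub> X" "X \<in> carrier Q" "Y \<in> carrier Q"
  then obtain x y where c: "x \<in> carrier L" "y \<in> carrier L" and eq: "X = q x" "Y = q y"
      and xy: "(x \<sqinter> y, x) \<in> C" "(y \<sqinter> x, y) \<in> C"
    by (auto simp: carrier_Q le_Q_iff)
  have "(x, y) \<in> C"
    using C_trans[OF C_sym[OF xy(1)]] xy(2) unfolding meet_comm[of L y x] by blast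
  with c eq have "X = Y" by (simp add: q_eq_iff)
  then show "X .=\<^bsub>Q\<^esub> Y" by (simp add: quotient_kframe_def)
next
  fix X Y Z
  assume XYZ: "X \<sqsubseteq>\<^bsub>Q\<^esub> Y" "Y \<sqsubseteq>\<^bsub>Q\<^esub> Z" "X \<in> carrier Q" "Y \<in> carrier Q" "Z \<in> carrier Q"
  then obtain x y z where c: "x \<in> carrier L" "y \<in> carrier L" "z \<in> carrier L"
      and eq: "X = q x" "Y = q y" "Z = q z"
    by (auto simp: carrier_Q)
  then have xy: "(x \<sqinter> y, x) \<in> C" and yz: "(y \<sqinter> z, y) \<in> C"
    using XYZ by (auto simp: le_Q_iff)
  have "(x \<sqinter> y \<sqinter> z, x \<sqinter> z) \<in> C" using C_meet[OF xy C_refl] c by blast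
  moreover have "(x \<sqinter> (y \<sqinter> z), x \<sqinter> y) \<in> C" using C_meet[OF C_refl yz] c by blast
  moreover have "x \<sqinter> y \<sqinter> z = x \<sqinter> (y \<sqinter> z)"
    using c weak_meet_assoc eq_is_equal by simp
  ultimately have "(x \<sqinter> z, x) \<in> C" using xy C_sym C_trans by metis
  then show "X \<sqsubseteq>\<^bsub>Q\<^esub> Z" using c eq by (simp add: le_Q_iff)
qed (auto simp: quotient_kframe_def)

text \<open>If \<open>[z]\<close> lies below every \<open>[a]\<close>, then \<open>C\<close> relates \<open>z \<and> a\<close> to \<open>z\<close> for every \<open>a\<close>. Taking the meet
  of these pairs relates \<open>z \<and> \<Sqinter>F\<close> to \<open>z\<close>. For \<open>\<kappa>\<close>-joins the analogous argument needs the
  distributive law.\<close>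

lemma is_glb_Q:
  assumes F: "finite F" "F \<subseteq> carrier L"
  shows "is_glb Q (q (\<Sqinter>F)) (q ` F)"
proof -
  have greatest: "q z \<sqsubseteq>\<^bsub>Q\<^esub> q (\<Sqinter>F)" if z: "z \<in> carrier L" and le: "\<And>a. a \<in> F \<Longrightarrow> q z \<sqsubseteq>\<^bsub>Q\<^esub> q a" for z
  proof -
    \<comment> \<open>The added top element contributes the pair \<open>(z, z)\<close>, so that the constant family has
        meet \<open>z\<close> even when \<open>F\<close> is empty.\<close>
    have "(z \<sqinter> a, z) \<in> C" if a: "a \<in> insert \<top> F" for a
      using a
    proof
      assume "a = \<top>"
      then show ?thesis using z by (simp add: meet_absorb top_higher C_refl)
    next
      assume "a \<in> F"
      moreover from this have "a \<in> carrier L" using F by blast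
      ultimately show ?thesis using le z le_Q_iff by blast
    qed
    then have "(\<Sqinter>((\<lambda>a. z \<sqinter> a) ` insert \<top> F), \<Sqinter>((\<lambda>a. z) ` insert \<top> F)) \<in> C"
      using F by (intro C_inf) auto
    moreover have "\<Sqinter>((\<lambda>a. z) ` insert \<top> F) = z"
    proof -
      have "(\<lambda>a. z) ` insert \<top> F = {z}" by auto
      then show ?thesis using z weak_inf_of_singleton eq_is_equal by metis
    qed
    moreover have "\<Sqinter>((\<lambda>a. z \<sqinter> a) ` insert \<top> F) = z \<sqinter> \<Sqinter>F"
    proof (rule le_antisym)
      let ?G = "(\<lambda>a. z \<sqinter> a) ` insert \<top> F"
      have G: "finite ?G" "?G \<subseteq> carrier L" using F z by auto
      have "\<Sqinter>?G \<sqsubseteq> z"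
      proof (rule le_trans)
        show "\<Sqinter>?G \<sqsubseteq> z \<sqinter> \<top>" using G by (intro inf_lower) auto
        show "z \<sqinter> \<top> \<sqsubseteq> z" using z by (intro meet_left) auto
      qed (use G z in auto)
      moreover have "\<Sqinter>?G \<sqsubseteq> a" if "a \<in> F" for a
      proof (rule le_trans)
        show "\<Sqinter>?G \<sqsubseteq> z \<sqinter> a" using G that by (intro inf_lower) auto
        show "z \<sqinter> a \<sqsubseteq> a" using z F that by (intro meet_right) auto
      qed (use G z F that in auto)
      ultimately show "\<Sqinter>?G \<sqsubseteq> z \<sqinter> \<Sqinter>F"
        using F G z by (intro meet_le inf_greatest) auto
      have "z \<sqinter> \<Sqinter>F \<sqsubseteq> z \<sqinter> a" if "a \<in> insert \<top> F" for a
      proof -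
        have "\<Sqinter>F \<sqsubseteq> a" using that F by (auto simp: top_higher inf_lower)
        then have "z \<sqinter> \<Sqinter>F \<sqsubseteq> a"
          using le_trans[OF meet_right[of z "\<Sqinter>F"], of a] F z that by auto
        then show ?thesis using F z that by (intro meet_le) (auto intro: meet_left)
      qed
      then show "z \<sqinter> \<Sqinter>F \<sqsubseteq> \<Sqinter>?G" using F G z by (intro inf_greatest) auto
    qed (use F z in \<open>auto intro!: inf_closed\<close>)
    ultimately show ?thesis using z F by (simp add: le_Q_iff)
  qed
  have "q (\<Sqinter>F) \<sqsubseteq>\<^bsub>Q\<^esub> q a" if "a \<in> F" for a
    using F that by (intro q_mono inf_lower) auto
  moreover have "q (\<Sqinter>F) \<in> carrier Q" using F by (simp add: carrier_Q)
  moreover have sub: "q ` F \<subseteq> carrier Q" using F by (auto simp: carrier_Q)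
  ultimately show ?thesis
  proof (intro greatest_LowerI)
    fix Z assume "Z \<in> Lower Q (q ` F)"
    then have "Z \<in> carrier Q" "\<And>a. a \<in> F \<Longrightarrow> Z \<sqsubseteq>\<^bsub>Q\<^esub> q a"
      using sub unfolding Lower_def by blast+
    then show "Z \<sqsubseteq>\<^bsub>Q\<^esub> q (\<Sqinter>F)" using greatest by (auto simp: carrier_Q)
  qed auto
qed

lemma is_lub_Q:
  assumes A: "kset \<kappa> A" "A \<subseteq> carrier L"
  shows "is_lub Q (q (\<Squnion>A)) (q ` A)"
proof -
  have least: "q (\<Squnion>A) \<sqsubseteq>\<^bsub>Q\<^esub> q z" if z: "z \<in> carrier L" and le: "\<And>a. a \<in> A \<Longrightarrow> q a \<sqsubseteq>\<^bsub>Q\<^esub> q z" for z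
  proof -
    have "(z \<sqinter> a, a) \<in> C" if "a \<in> A" for a
    proof -
      have "a \<in> carrier L" using A that by blast
      then show ?thesis using le[OF that] z by (simp add: le_Q_iff meet_comm)
    qed
    then have "(\<Squnion>((\<lambda>a. z \<sqinter> a) ` A), \<Squnion>((\<lambda>a. a) ` A)) \<in> C"
      using A by (intro C_sup)
    then have "(z \<sqinter> \<Squnion>A, \<Squnion>A) \<in> C" using A z by (simp add: meet_distrib_ksup)
    then show ?thesis using A z by (simp add: le_Q_iff meet_comm)
  qed
  have "q a \<sqsubseteq>\<^bsub>Q\<^esub> q (\<Squnion>A)" if "a \<in> A" for a
    using A that by (intro q_mono ksup_upper) auto
  moreover have "q (\<Squnion>A) \<in> carrier Q" using A by (simp add: carrier_Q)
  moreover have sub: "q ` A \<subseteq> carrier Q" using A by (auto simp: carrier_Q)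
  ultimately show ?thesis
  proof (intro least_UpperI)
    fix Z assume "Z \<in> Upper Q (q ` A)"
    then have "Z \<in> carrier Q" "\<And>a. a \<in> A \<Longrightarrow> q a \<sqsubseteq>\<^bsub>Q\<^esub> Z"
      using sub unfolding Upper_def by blast+
    then show "q (\<Squnion>A) \<sqsubseteq>\<^bsub>Q\<^esub> Z" using least by (auto simp: carrier_Q)
  qed auto
qed

lemma Inf_Q: "finite F \<Longrightarrow> F \<subseteq> carrier L \<Longrightarrow> \<Sqinter>\<^bsub>Q\<^esub>(q ` F) = q (\<Sqinter>F)"
  using partial_order.inf_eqI[OF partial_order_Q is_glb_Q] .

lemma Sup_Q: "kset \<kappa> A \<Longrightarrow> A \<subseteq> carrier L \<Longrightarrow> \<Squnion>\<^bsub>Q\<^esub>(q ` A) = q (\<Squnion>A)"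
  using partial_order.sup_eqI[OF partial_order_Q is_lub_Q] .

lemma meet_Q: "x \<in> carrier L \<Longrightarrow> y \<in> carrier L \<Longrightarrow> q x \<sqinter>\<^bsub>Q\<^esub> q y = q (x \<sqinter> y)"
  using Inf_Q[of "{x, y}"] by (simp add: meet_def)

lemma join_Q: "x \<in> carrier L \<Longrightarrow> y \<in> carrier L \<Longrightarrow> q x \<squnion>\<^bsub>Q\<^esub> q y = q (x \<squnion> y)"
  using Sup_Q[of "{x, y}"] regular by (simp add: join_def kset_finite)

text \<open>A \<open>\<kappa>\<close>-set of classes is the image of a \<open>\<kappa>\<close>-set of representatives, so every law of a
  \<open>\<kappa>\<close>-frame passes from \<open>L\<close> to the quotient.\<close>

lemma regular_kframe_Q: "regular_kframe Q \<kappa>"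
proof -
  interpret Q: partial_order Q by (rule partial_order_Q)
  have lub: "\<exists>s. is_lub Q s B" if B: "B \<subseteq> carrier Q" "kset \<kappa> B" for B
  proof -
    obtain A where "A \<subseteq> carrier L" "B = q ` A" "kset \<kappa> A"
      using kset_subset_image[of \<kappa> B q "carrier L"] B unfolding carrier_Q by blast
    then show ?thesis using is_lub_Q by blast
  qed
  have glb: "\<exists>s. is_glb Q s B" if B: "B \<subseteq> carrier Q" "finite B" for B
  proof -
    obtain A where "A \<subseteq> carrier L" "B = q ` A" "finite A"
      using finite_subset_image[of B q "carrier L"] B unfolding carrier_Q by blast
    then show ?thesis using is_glb_Q by blast
  qed
  show ?thesis
  proof
    fix X Y assume "X \<in> carrier Q" "Y \<in> carrier Q"
    then show "\<exists>s. is_lub Q s {X, Y}" "\<exists>s. is_glb Q s {X, Y}"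
      using lub glb regular by (simp_all add: kset_finite)
  next
    show "\<exists>s. least Q s (carrier Q)" "\<exists>s. greatest Q s (carrier Q)"
      using lub[of "{}"] glb[of "{}"] regular by (simp_all add: kset_finite Upper_empty Lower_empty)
  next
    fix X Y Z assume "X \<in> carrier Q" "Y \<in> carrier Q" "Z \<in> carrier Q"
    then show "X \<sqinter>\<^bsub>Q\<^esub> (Y \<squnion>\<^bsub>Q\<^esub> Z) = X \<sqinter>\<^bsub>Q\<^esub> Y \<squnion>\<^bsub>Q\<^esub> (X \<sqinter>\<^bsub>Q\<^esub> Z)"
      by (auto simp: carrier_Q meet_Q join_Q meet_distrib_join)
  next
    fix X B assume X: "X \<in> carrier Q" and B: "B \<subseteq> carrier Q" "kset \<kappa> B"
    obtain A where A: "A \<subseteq> carrier L" "B = q ` A" "kset \<kappa> A"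
      using kset_subset_image[of \<kappa> B q "carrier L"] B unfolding carrier_Q by blast
    obtain x where x: "x \<in> carrier L" "X = q x" using X by (auto simp: carrier_Q)
    have "(\<lambda>Y. X \<sqinter>\<^bsub>Q\<^esub> Y) ` B = q ` (\<lambda>a. x \<sqinter> a) ` A"
      using A x by (auto simp: meet_Q image_image subset_iff intro!: image_cong)
    moreover have "(\<lambda>a. x \<sqinter> a) ` A \<subseteq> carrier L" using A x by auto
    ultimately show "X \<sqinter>\<^bsub>Q\<^esub> (\<Squnion>\<^bsub>Q\<^esub>B) = \<Squnion>\<^bsub>Q\<^esub>((\<lambda>Y. X \<sqinter>\<^bsub>Q\<^esub> Y) ` B)"
      using A x by (simp add: Sup_Q meet_Q kset_image meet_distrib_ksup)
  qed (use lub regular in auto)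
qed

lemma spectrum_Q_pullback:
  assumes "\<psi> \<in> spectrum \<kappa> Q"
  shows "(\<lambda>x\<in>carrier L. \<psi> (q x)) \<in> spectrum \<kappa> L"
proof -
  have "\<psi> (q (\<Sqinter>F)) = (\<forall>a\<in>F. \<psi> (q a))" if F: "finite F" "F \<subseteq> carrier L" for F
  proof -
    have "finite (q ` F)" "q ` F \<subseteq> carrier Q" using F by (auto simp: carrier_Q)
    then have "\<psi> (\<Sqinter>\<^bsub>Q\<^esub>(q ` F)) = (\<forall>a\<in>q ` F. \<psi> a)" using assms unfolding spectrum_iff by blast
    then show ?thesis using F by (simp add: Inf_Q)
  qed
  moreover have "\<psi> (q (\<Squnion>A)) = (\<exists>a\<in>A. \<psi> (q a))" if A: "kset \<kappa> A" "A \<subseteq> carrier L" for A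
  proof -
    have "kset \<kappa> (q ` A)" "q ` A \<subseteq> carrier Q" using A kset_image by (auto simp: carrier_Q)
    then have "\<psi> (\<Squnion>\<^bsub>Q\<^esub>(q ` A)) = (\<exists>a\<in>q ` A. \<psi> a)" using assms unfolding spectrum_iff by blast
    then show ?thesis using A by (simp add: Sup_Q)
  qed
  ultimately show ?thesis unfolding spectrum_iff by (auto simp: subset_iff)
qed

text \<open>A point whose kernel contains \<open>C\<close> is constant on classes, so it factors through the quotient.\<close>

lemma spectrum_Q_factor:
  assumes \<phi>: "\<phi> \<in> spectrum \<kappa> L" and C: "\<And>x y. (x, y) \<in> C \<Longrightarrow> \<phi> x = \<phi> y"
  shows "\<exists>\<psi>\<in>spectrum \<kappa> Q. \<forall>x\<in>carrier L. \<psi> (q x) = \<phi> x"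
proof -
  define \<psi> where "\<psi> = (\<lambda>X\<in>carrier Q. \<exists>x\<in>X. \<phi> x)"
  have \<psi>_q: "\<psi> (q x) = \<phi> x" if x: "x \<in> carrier L" for x
  proof -
    have "\<psi> (q x) = (\<exists>y\<in>q x. \<phi> y)" using x by (simp add: \<psi>_def carrier_Q)
    also have "\<dots> = (\<exists>y\<in>q x. \<phi> x)" using C[of x] by (intro bex_cong) auto
    also have "\<dots> = \<phi> x" using C_refl[OF x] by auto
    finally show ?thesis .
  qed
  have "\<psi> (\<Sqinter>\<^bsub>Q\<^esub>F) = (\<forall>X\<in>F. \<psi> X)" if F: "finite F" "F \<subseteq> carrier Q" for F
  proof -
    obtain A where "A \<subseteq> carrier L" "F = q ` A" "finite A"
      using finite_subset_image[of F q "carrier L"] F unfolding carrier_Q by blast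
    moreover from this have "\<phi> (\<Sqinter>A) = (\<forall>a\<in>A. \<phi> a)" using \<phi> unfolding spectrum_iff by blast
    ultimately show ?thesis by (simp add: Inf_Q \<psi>_q subset_iff)
  qed
  moreover have "\<psi> (\<Squnion>\<^bsub>Q\<^esub>F) = (\<exists>X\<in>F. \<psi> X)" if F: "kset \<kappa> F" "F \<subseteq> carrier Q" for F
  proof -
    obtain A where "A \<subseteq> carrier L" "F = q ` A" "kset \<kappa> A"
      using kset_subset_image[of \<kappa> F q "carrier L"] F unfolding carrier_Q by blast
    moreover from this have "\<phi> (\<Squnion>A) = (\<exists>a\<in>A. \<phi> a)" using \<phi> unfolding spectrum_iff by blast
    moreover have "(\<exists>a\<in>A. \<psi> (q a)) = (\<exists>a\<in>A. \<phi> a)"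
      using calculation(1) by (intro bex_cong) (auto simp: \<psi>_q)
    ultimately show ?thesis by (simp add: Sup_Q \<psi>_q)
  qed
  moreover have "\<psi> \<in> extensional (carrier Q)" by (simp add: \<psi>_def)
  ultimately have "\<psi> \<in> spectrum \<kappa> Q" unfolding spectrum_iff by blast
  then show ?thesis using \<psi>_q by (intro bexI ballI)
qed

end

section \<open>Prime congruences\<close>

context regular_kframe
begin

text \<open>For an arbitrary function this is only an equivalence relation; it is a congruence when
  \<open>f\<close> is a point.\<close>

definition point_kernel where
  "point_kernel f = {(x, y) \<in> carrier L \<times> carrier L. f x = f y}"

lemma with_congruence: "kframe_congruence \<kappa> L C \<Longrightarrow> kframe_with_congruence L \<kappa> C"
  by unfold_locales

lemma congruence_Int:
  assumes "kframe_congruence \<kappa> L A" "kframe_congruence \<kappa> L B"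
  shows "kframe_congruence \<kappa> L (A \<inter> B)"
  using assms unfolding kframe_congruence_def
  by (auto simp: equiv_def refl_on_def intro: sym_Int trans_Int)

lemma congruence_full: "kframe_congruence \<kappa> L (carrier L \<times> carrier L)"
proof (rule kframe_congruenceI)
  show "equiv (carrier L) (carrier L \<times> carrier L)"
    by (auto simp: equiv_def refl_on_def sym_def trans_def)
next
  fix S assume S: "kset \<kappa> S" "S \<subseteq> carrier L \<times> carrier L"
  then have "fst ` S \<subseteq> carrier L" "snd ` S \<subseteq> carrier L" by auto
  with S show "(\<Squnion>(fst ` S), \<Squnion>(snd ` S)) \<in> carrier L \<times> carrier L" by (simp add: kset_image)
qed auto

lemma prime_congruence_iff:
  "prime_element (congruence_frame \<kappa> L) P \<longleftrightarrow>
    kframe_congruence \<kappa> L P \<and> P \<noteq> carrier L \<times> carrier L \<and>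
    (\<forall>A B. kframe_congruence \<kappa> L A \<and> kframe_congruence \<kappa> L B \<and> A \<inter> B \<subseteq> P \<longrightarrow>
      A \<subseteq> P \<or> B \<subseteq> P)"
proof -
  let ?F = "congruence_frame \<kappa> L"
  interpret F: partial_order ?F
    unfolding congruence_frame_def by (rule partial_order_inclusion_order)
  have sub: "A \<subseteq> carrier L \<times> carrier L" if "kframe_congruence \<kappa> L A" for A
    using that unfolding kframe_congruence_def equiv_def by blast
  have top: "greatest ?F (carrier L \<times> carrier L) (carrier ?F)"
    using sub congruence_full by (auto simp: greatest_def congruence_frame_def inclusion_order_def)
  then have "\<top>\<^bsub>?F\<^esub> = carrier L \<times> carrier L"
    unfolding top_def by (rule some_equality) (rule F.greatest_unique[OF _ top])
  moreover have "A \<sqinter>\<^bsub>?F\<^esub> B = A \<inter> B" if "kframe_congruence \<kappa> L A" "kframe_congruence \<kappa> L B" for A B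
    unfolding meet_def
    by (rule F.inf_eqI)
      (use that congruence_Int in
        \<open>auto simp: greatest_def Lower_def congruence_frame_def inclusion_order_def\<close>)
  moreover have "carrier ?F = {A. kframe_congruence \<kappa> L A}" "\<And>A B. A \<sqsubseteq>\<^bsub>?F\<^esub> B \<longleftrightarrow> A \<subseteq> B"
    by (simp_all add: congruence_frame_def inclusion_order_def)
  ultimately show ?thesis
    unfolding prime_element_def by simp blast
qed

lemma congruence_point_kernel:
  assumes f: "f \<in> spectrum \<kappa> L"
  shows "kframe_congruence \<kappa> L (point_kernel f)"
proof (rule kframe_congruenceI)
  show "equiv (carrier L) (point_kernel f)"
    by (auto simp: equiv_def refl_on_def sym_def trans_def point_kernel_def)
next
  fix x y u v assume "(x, y) \<in> point_kernel f" "(u, v) \<in> point_kernel f"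
  then show "(x \<sqinter> u, y \<sqinter> v) \<in> point_kernel f"
    by (auto simp: point_kernel_def spectrum_meet[OF f])
next
  fix S assume S: "kset \<kappa> S" "S \<subseteq> point_kernel f"
  then have sub: "fst ` S \<subseteq> carrier L" "snd ` S \<subseteq> carrier L" by (auto simp: point_kernel_def)
  moreover have k: "kset \<kappa> (fst ` S)" "kset \<kappa> (snd ` S)" using S by (auto intro: kset_image)
  ultimately have "f (\<Squnion>(fst ` S)) = (\<exists>x\<in>fst ` S. f x)" "f (\<Squnion>(snd ` S)) = (\<exists>x\<in>snd ` S. f x)"
    using f unfolding spectrum_iff by blast+
  moreover have "(\<exists>x\<in>fst ` S. f x) = (\<exists>x\<in>snd ` S. f x)"
    using S by (force simp: point_kernel_def)
  ultimately show "(\<Squnion>(fst ` S), \<Squnion>(snd ` S)) \<in> point_kernel f"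
    using sub k by (simp add: point_kernel_def)
qed

text \<open>Suppose \<open>(x, y) \<in> A\<close> and \<open>(u, v) \<in> B\<close> with \<open>f x = f u = 0\<close> and \<open>f y = f v = 1\<close>, and put
  \<open>w = y \<and> v\<close>. Modulo \<open>A\<close> the element \<open>(x \<or> u) \<and> w\<close> becomes \<open>(y \<or> u) \<and> w = w\<close>, modulo \<open>B\<close> it becomes
  \<open>(x \<or> v) \<and> w = w\<close>. Hence \<open>A \<inter> B\<close> identifies it with \<open>w\<close>, but \<open>f\<close> sends it to \<open>0\<close> and \<open>w\<close> to \<open>1\<close>.\<close>

lemma prime_point_kernel:
  assumes f: "f \<in> spectrum \<kappa> L"
  shows "prime_element (congruence_frame \<kappa> L) (point_kernel f)"
proof -
  have separated: "\<exists>x y. (x, y) \<in> A \<and> \<not> f x \<and> f y"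
    if A: "kframe_congruence \<kappa> L A" and not_sub: "\<not> A \<subseteq> point_kernel f" for A
  proof -
    interpret A: kframe_with_congruence L \<kappa> A using A by (rule with_congruence)
    obtain x y where "(x, y) \<in> A" "f x \<noteq> f y"
      using not_sub A.C_closed by (auto simp: point_kernel_def)
    then show ?thesis using A.C_sym by metis
  qed
  have "A \<subseteq> point_kernel f \<or> B \<subseteq> point_kernel f"
    if A: "kframe_congruence \<kappa> L A" and B: "kframe_congruence \<kappa> L B"
      and sub: "A \<inter> B \<subseteq> point_kernel f" for A B
  proof (rule ccontr)
    assume contra: "\<not> (A \<subseteq> point_kernel f \<or> B \<subseteq> point_kernel f)"
    interpret A: kframe_with_congruence L \<kappa> A using A by (rule with_congruence)
    interpret B: kframe_with_congruence L \<kappa> B using B by (rule with_congruence)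
    obtain x y u v where xy: "(x, y) \<in> A" "\<not> f x" "f y" and uv: "(u, v) \<in> B" "\<not> f u" "f v"
      using contra separated[OF A] separated[OF B] by blast
    have c: "x \<in> carrier L" "y \<in> carrier L" "u \<in> carrier L" "v \<in> carrier L"
      using xy uv A.C_closed B.C_closed by auto
    let ?w = "y \<sqinter> v"
    have "?w \<sqsubseteq> y" "?w \<sqsubseteq> v" "y \<sqsubseteq> y \<squnion> u" "v \<sqsubseteq> x \<squnion> v"
      using c by (auto intro: meet_left meet_right join_left join_right)
    then have "?w \<sqsubseteq> y \<squnion> u" "?w \<sqsubseteq> x \<squnion> v" using c le_trans by (meson join_closed meet_closed)+
    then have w: "(y \<squnion> u) \<sqinter> ?w = ?w" "(x \<squnion> v) \<sqinter> ?w = ?w"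
      using c meet_absorb[of ?w "y \<squnion> u"] meet_absorb[of ?w "x \<squnion> v"]
        meet_comm[of L ?w "y \<squnion> u"] meet_comm[of L ?w "x \<squnion> v"] by simp_all
    have "((x \<squnion> u) \<sqinter> ?w, (y \<squnion> u) \<sqinter> ?w) \<in> A"
      using A.C_meet[OF A.C_join[OF xy(1) A.C_refl] A.C_refl] c by simp
    moreover have "((x \<squnion> u) \<sqinter> ?w, (x \<squnion> v) \<sqinter> ?w) \<in> B"
      using B.C_meet[OF B.C_join[OF B.C_refl uv(1)] B.C_refl] c by simp
    ultimately have "((x \<squnion> u) \<sqinter> ?w, ?w) \<in> point_kernel f" using w sub by auto
    then show False
      using c xy uv by (simp add: point_kernel_def spectrum_meet[OF f] spectrum_join[OF f])
  qed
  \<comment> \<open>The kernel is proper because \<open>f\<close> separates top and bottom, which are the empty meet and join.\<close>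
  moreover have "(\<Sqinter>{}, \<Squnion>{}) \<notin> point_kernel f"
  proof -
    have "f (\<Sqinter>{})" "\<not> f (\<Squnion>{})"
      using f kset_finite[OF regular finite.emptyI] unfolding spectrum_iff by auto
    then show ?thesis by (simp add: point_kernel_def)
  qed
  moreover have "(\<Sqinter>{}, \<Squnion>{}) \<in> carrier L \<times> carrier L"
    using ksup_closed[OF kset_finite[OF regular finite.emptyI] empty_subsetI] by simp
  ultimately show ?thesis
    unfolding prime_congruence_iff using congruence_point_kernel[OF f] by metis
qed

text \<open>These are the congruences of the open and the closed sublocale defined by \<open>a\<close>: the least
  congruences that identify \<open>a\<close> with the top and with the bottom element respectively.\<close>

definition open_congruence where
  "open_congruence a = {(x, y) \<in> carrier L \<times> carrier L. a \<sqinter> x = a \<sqinter> y}"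

definition closed_congruence where
  "closed_congruence a = {(x, y) \<in> carrier L \<times> carrier L. x \<squnion> a = y \<squnion> a}"

lemma congruence_open:
  assumes a: "a \<in> carrier L"
  shows "kframe_congruence \<kappa> L (open_congruence a)"
proof (rule kframe_congruenceI)
  show "equiv (carrier L) (open_congruence a)"
    by (auto simp: equiv_def refl_on_def sym_def trans_def open_congruence_def)
next
  fix x y u v assume "(x, y) \<in> open_congruence a" "(u, v) \<in> open_congruence a"
  then have c: "x \<in> carrier L" "y \<in> carrier L" "u \<in> carrier L" "v \<in> carrier L"
    and eq: "a \<sqinter> x = a \<sqinter> y" "a \<sqinter> u = a \<sqinter> v" by (auto simp: open_congruence_def)
  have assoc: "(r \<sqinter> s) \<sqinter> t = r \<sqinter> (s \<sqinter> t)"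
    if "r \<in> carrier L" "s \<in> carrier L" "t \<in> carrier L" for r s t
    using that weak_meet_assoc eq_is_equal by simp
  have "a \<sqinter> (x \<sqinter> u) = (a \<sqinter> y) \<sqinter> u" using assoc[of a x u] a c eq by simp
  also have "\<dots> = y \<sqinter> (a \<sqinter> u)" using assoc[of y a u] a c by (simp add: meet_comm)
  also have "\<dots> = y \<sqinter> (a \<sqinter> v)" using eq by simp
  also have "\<dots> = (a \<sqinter> y) \<sqinter> v" using assoc[of y a v] a c by (simp add: meet_comm)
  also have "\<dots> = a \<sqinter> (y \<sqinter> v)" using assoc[of a y v] a c by simp
  finally show "(x \<sqinter> u, y \<sqinter> v) \<in> open_congruence a" using c by (simp add: open_congruence_def)
next
  fix S assume S: "kset \<kappa> S" "S \<subseteq> open_congruence a"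
  then have sub: "fst ` S \<subseteq> carrier L" "snd ` S \<subseteq> carrier L" by (auto simp: open_congruence_def)
  moreover have k: "kset \<kappa> (fst ` S)" "kset \<kappa> (snd ` S)" using S by (auto intro: kset_image)
  moreover have "(\<lambda>x. a \<sqinter> x) ` fst ` S = (\<lambda>x. a \<sqinter> x) ` snd ` S"
    using S unfolding image_image by (intro image_cong) (auto simp: open_congruence_def)
  ultimately have "a \<sqinter> \<Squnion>(fst ` S) = a \<sqinter> \<Squnion>(snd ` S)" using a by (simp add: meet_distrib_ksup)
  with sub k show "(\<Squnion>(fst ` S), \<Squnion>(snd ` S)) \<in> open_congruence a"
    by (simp add: open_congruence_def)
qed

lemma congruence_closed:
  assumes a: "a \<in> carrier L"
  shows "kframe_congruence \<kappa> L (closed_congruence a)"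
proof (rule kframe_congruenceI)
  show "equiv (carrier L) (closed_congruence a)"
    by (auto simp: equiv_def refl_on_def sym_def trans_def closed_congruence_def)
next
  fix x y u v assume "(x, y) \<in> closed_congruence a" "(u, v) \<in> closed_congruence a"
  then show "(x \<sqinter> u, y \<sqinter> v) \<in> closed_congruence a"
    using a by (auto simp: closed_congruence_def join_distrib_meet)
next
  have le: "\<Squnion>(g ` S) \<squnion> a \<sqsubseteq> \<Squnion>(h ` S) \<squnion> a"
    if S: "kset \<kappa> S" and c: "\<And>p. p \<in> S \<Longrightarrow> g p \<in> carrier L \<and> h p \<in> carrier L"
      and eq: "\<And>p. p \<in> S \<Longrightarrow> g p \<squnion> a = h p \<squnion> a" for g h and S :: "('a \<times> 'a) set"
  proof -
    have k: "kset \<kappa> (g ` S)" "kset \<kappa> (h ` S)" "g ` S \<subseteq> carrier L" "h ` S \<subseteq> carrier L"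
      using S c by (auto intro: kset_image)
    let ?t = "\<Squnion>(h ` S) \<squnion> a"
    have t: "\<Squnion>(h ` S) \<in> carrier L" "?t \<in> carrier L" using k a by auto
    have "g p \<sqsubseteq> ?t" if p: "p \<in> S" for p
    proof (rule le_trans)
      show "g p \<sqsubseteq> h p \<squnion> a" using c[OF p] a join_left[of "g p" a] by (simp add: eq[OF p])
      have "h p \<sqsubseteq> \<Squnion>(h ` S)" using k p by (intro ksup_upper) auto
      then have "h p \<sqsubseteq> ?t" using le_trans[OF _ join_left[of "\<Squnion>(h ` S)" a]] c[OF p] t a by auto
      then show "h p \<squnion> a \<sqsubseteq> ?t" using c[OF p] t a by (intro join_le) (auto intro: join_right)
    qed (use c[OF p] t a in auto)
    then have "\<Squnion>(g ` S) \<sqsubseteq> ?t" using k t by (intro ksup_least) auto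
    then show ?thesis using k t a by (intro join_le) (auto intro: join_right)
  qed
  fix S assume S: "kset \<kappa> S" "S \<subseteq> closed_congruence a"
  then have sub: "fst ` S \<subseteq> carrier L" "snd ` S \<subseteq> carrier L" by (auto simp: closed_congruence_def)
  moreover have k: "kset \<kappa> (fst ` S)" "kset \<kappa> (snd ` S)" using S by (auto intro: kset_image)
  moreover have "\<Squnion>(fst ` S) \<squnion> a = \<Squnion>(snd ` S) \<squnion> a"
  proof (rule le_antisym)
    show "\<Squnion>(fst ` S) \<squnion> a \<sqsubseteq> \<Squnion>(snd ` S) \<squnion> a" "\<Squnion>(snd ` S) \<squnion> a \<sqsubseteq> \<Squnion>(fst ` S) \<squnion> a"
      using S by (auto intro!: le simp: closed_congruence_def)
  qed (use sub k a in auto)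
  ultimately show "(\<Squnion>(fst ` S), \<Squnion>(snd ` S)) \<in> closed_congruence a"
    by (simp add: closed_congruence_def)
qed

text \<open>Relative complements in a distributive lattice are unique: \<open>x = x \<and> (y \<or> a) = (x \<and> y) \<or> (a \<and> x)\<close>,
  and the last term is symmetric in \<open>x\<close> and \<open>y\<close> as \<open>a \<and> x = a \<and> y\<close>.\<close>

lemma open_Int_closed:
  assumes a: "a \<in> carrier L"
  shows "open_congruence a \<inter> closed_congruence a \<subseteq> Id"
proof clarify
  fix x y assume "(x, y) \<in> open_congruence a" "(x, y) \<in> closed_congruence a"
  then have c: "x \<in> carrier L" "y \<in> carrier L"
    and eq: "a \<sqinter> x = a \<sqinter> y" "x \<squnion> a = y \<squnion> a"
    by (auto simp: open_congruence_def closed_congruence_def)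
  have absorb: "z = (z \<sqinter> w) \<squnion> (a \<sqinter> z)"
    if "z \<in> carrier L" "w \<in> carrier L" "z \<squnion> a = w \<squnion> a" for z w
  proof -
    have "z = z \<sqinter> (w \<squnion> a)"
      using meet_absorb[of z "z \<squnion> a"] join_left[of z a] that a by simp
    also have "\<dots> = (z \<sqinter> w) \<squnion> (a \<sqinter> z)" using that a by (simp add: meet_distrib_join meet_comm)
    finally show ?thesis .
  qed
  show "x = y"
    using absorb[of x y] absorb[of y x] c eq meet_comm by metis
qed

lemma prime_congruence_two_classes:
  assumes P: "prime_element (congruence_frame \<kappa> L) P" and a: "a \<in> carrier L"
  shows "(a, \<top>) \<in> P \<or> (a, \<bottom>) \<in> P"
proof -
  interpret P: kframe_with_congruence L \<kappa> P
    using P by (intro with_congruence) (simp add: prime_congruence_iff)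
  have "open_congruence a \<inter> closed_congruence a \<subseteq> P"
    using open_Int_closed[OF a] P.C_refl by (auto simp: open_congruence_def)
  then have "open_congruence a \<subseteq> P \<or> closed_congruence a \<subseteq> P"
    using P congruence_open[OF a] congruence_closed[OF a] unfolding prime_congruence_iff by blast
  moreover have "(a, \<top>) \<in> open_congruence a"
    using a meet_absorb[of a a] meet_absorb[of a \<top>] by (simp add: open_congruence_def top_higher)
  moreover have "(a, \<bottom>) \<in> closed_congruence a"
    using a join_absorb[of a a] join_absorb[of \<bottom> a] by (simp add: closed_congruence_def bottom_lower)
  ultimately show ?thesis by blast
qed

text \<open>The point belonging to \<open>P\<close> is the quotient map onto the two-element quotient \<open>L / P\<close>: it sends
  the class of the top element to true and the class of the bottom element to false.\<close>

lemma prime_congruence_is_point_kernel: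
  assumes P: "prime_element (congruence_frame \<kappa> L) P"
  obtains f where "f \<in> spectrum \<kappa> L" "P = point_kernel f"
proof
  interpret P: kframe_with_congruence L \<kappa> P
    using P by (intro with_congruence) (simp add: prime_congruence_iff)
  define f where "f = (\<lambda>x\<in>carrier L. (x, \<top>) \<in> P)"
  have fx: "f x \<longleftrightarrow> (x, \<top>) \<in> P" if "x \<in> carrier L" for x using that by (simp add: f_def)
  have proper: "(\<bottom>, \<top>) \<notin> P"
  proof
    assume bt: "(\<bottom>, \<top>) \<in> P"
    have top: "(x, \<top>) \<in> P" if "x \<in> carrier L" for x
      using prime_congruence_two_classes[OF P that]
      by (elim disjE) (assumption, erule P.C_trans[OF _ bt])
    have "(x, y) \<in> P" if "x \<in> carrier L" "y \<in> carrier L" for x y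
      using that by (intro P.C_trans[OF top P.C_sym[OF top]])
    then have "carrier L \<times> carrier L \<subseteq> P" by blast
    moreover have "P \<subseteq> carrier L \<times> carrier L" using P.C_equiv unfolding equiv_def by blast
    moreover have "P \<noteq> carrier L \<times> carrier L" using P unfolding prime_congruence_iff by (elim conjE)
    ultimately show False by (metis equalityI)
  qed
  have not_fx: "\<not> f x \<longleftrightarrow> (x, \<bottom>) \<in> P" if "x \<in> carrier L" for x
  proof
    assume "\<not> f x"
    then show "(x, \<bottom>) \<in> P" using prime_congruence_two_classes[OF P that] fx[OF that] by blast
  next
    assume bot: "(x, \<bottom>) \<in> P"
    show "\<not> f x" using P.C_trans[OF P.C_sym[OF bot]] proper fx[OF that] by blast
  qed
  have upward: "f y" if "f x" "x \<sqsubseteq> y" "x \<in> carrier L" "y \<in> carrier L" for x y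
  proof -
    have "(x \<squnion> y, \<top> \<squnion> y) \<in> P" using that P.C_refl fx by (intro P.C_join) auto
    moreover have "\<top> \<squnion> y = \<top>" using that top_join eq_is_equal by simp
    ultimately show ?thesis using that join_absorb[of x y] by (simp add: fx)
  qed
  have "f (\<Sqinter>F) = (\<forall>a\<in>F. f a)" if F: "finite F" "F \<subseteq> carrier L" for F
  proof
    assume "f (\<Sqinter>F)"
    then show "\<forall>a\<in>F. f a" using F upward[OF _ inf_lower[OF F]] inf_closed[OF F] by blast
  next
    assume "\<forall>a\<in>F. f a"
    then have "(\<Sqinter>((\<lambda>a. a) ` F), \<Sqinter>((\<lambda>a. \<top>) ` F)) \<in> P"
      using F fx by (intro P.C_inf) auto
    moreover have "\<Sqinter>((\<lambda>a. \<top>) ` F) = \<top>"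
      by (rule inf_eqI) (auto simp: greatest_def Lower_def top_higher)
    ultimately show "f (\<Sqinter>F)" using F fx by simp
  qed
  moreover have "f (\<Squnion>A) = (\<exists>a\<in>A. f a)" if A: "kset \<kappa> A" "A \<subseteq> carrier L" for A
  proof
    assume fA: "f (\<Squnion>A)"
    show "\<exists>a\<in>A. f a"
    proof (rule ccontr)
      assume "\<not> (\<exists>a\<in>A. f a)"
      then have "(\<Squnion>((\<lambda>a. a) ` A), \<Squnion>((\<lambda>a. \<bottom>) ` A)) \<in> P"
        using A not_fx by (intro P.C_sup) auto
      moreover have "\<Squnion>((\<lambda>a. \<bottom>) ` A) = \<bottom>"
        by (rule sup_eqI) (auto simp: least_def Upper_def bottom_lower)
      ultimately have "\<not> f (\<Squnion>A)" using A not_fx by simp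
      with fA show False by blast
    qed
  next
    assume "\<exists>a\<in>A. f a"
    then show "f (\<Squnion>A)" using A upward[OF _ ksup_upper[OF A]] ksup_closed[OF A] by blast
  qed
  moreover have "f \<in> extensional (carrier L)" by (simp add: f_def)
  ultimately show "f \<in> spectrum \<kappa> L" unfolding spectrum_iff by blast
  show "P = point_kernel f"
  proof (intro subset_antisym subrelI)
    fix x y assume xy: "(x, y) \<in> P"
    then have "(x, \<top>) \<in> P \<longleftrightarrow> (y, \<top>) \<in> P"
      using P.C_trans[OF xy] P.C_trans[OF P.C_sym[OF xy]] by blast
    then show "(x, y) \<in> point_kernel f"
      using P.C_closed[OF xy] by (simp add: point_kernel_def fx)
  next
    fix x y assume "(x, y) \<in> point_kernel f"
    then have c: "x \<in> carrier L" "y \<in> carrier L" and eq: "f x = f y"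
      by (auto simp: point_kernel_def)
    have "(x, \<top>) \<in> P \<and> (y, \<top>) \<in> P \<or> (x, \<bottom>) \<in> P \<and> (y, \<bottom>) \<in> P"
      using fx[OF c(1)] fx[OF c(2)] not_fx[OF c(1)] not_fx[OF c(2)] eq by blast
    then show "(x, y) \<in> P" by (elim disjE conjE) (rule P.C_trans[OF _ P.C_sym], assumption+)+
  qed
qed

end

text \<open>By the correspondence between points of the quotient and points of \<open>L\<close> above \<open>C\<close>, the criterion
  for a spatial \<open>\<kappa>\<close>-frame can be tested in \<open>L\<close>.\<close>

lemma (in kframe_with_congruence) spatial_congruence_iff:
  "spatial_congruence \<kappa> L C \<longleftrightarrow>
    (\<forall>x\<in>carrier L. \<forall>y\<in>carrier L.
      (\<forall>f\<in>spectrum \<kappa> L. C \<subseteq> point_kernel f \<longrightarrow> f x = f y) \<longrightarrow> (x, y) \<in> C)"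
proof -
  interpret Q: regular_kframe Q \<kappa> by (rule regular_kframe_Q)
  have points: "(\<forall>\<psi>\<in>spectrum \<kappa> Q. \<psi> (q x) = \<psi> (q y)) \<longleftrightarrow>
      (\<forall>f\<in>spectrum \<kappa> L. C \<subseteq> point_kernel f \<longrightarrow> f x = f y)"
    if xy: "x \<in> carrier L" "y \<in> carrier L" for x y
  proof (rule iffI; intro ballI impI)
    fix f assume *: "\<forall>\<psi>\<in>spectrum \<kappa> Q. \<psi> (q x) = \<psi> (q y)"
      and f: "f \<in> spectrum \<kappa> L" "C \<subseteq> point_kernel f"
    have "f u = f v" if "(u, v) \<in> C" for u v
    proof -
      have "(u, v) \<in> point_kernel f" using f(2) that by blast
      then show ?thesis by (simp add: point_kernel_def)
    qed
    with f(1) have "\<exists>\<psi>\<in>spectrum \<kappa> Q. \<forall>x\<in>carrier L. \<psi> (q x) = f x"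
      by (rule spectrum_Q_factor)
    then obtain \<psi> where \<psi>: "\<psi> \<in> spectrum \<kappa> Q"
      and \<psi>_q: "\<forall>x\<in>carrier L. \<psi> (q x) = f x" ..
    have "\<psi> (q x) = \<psi> (q y)" using * \<psi> by (rule bspec)
    then show "f x = f y" unfolding bspec[OF \<psi>_q xy(1)] bspec[OF \<psi>_q xy(2)] .
  next
    fix \<psi> assume *: "\<forall>f\<in>spectrum \<kappa> L. C \<subseteq> point_kernel f \<longrightarrow> f x = f y"
      and \<psi>: "\<psi> \<in> spectrum \<kappa> Q"
    let ?f = "\<lambda>x\<in>carrier L. \<psi> (q x)"
    have "C \<subseteq> point_kernel ?f"
    proof (rule subrelI)
      fix u v assume uv: "(u, v) \<in> C"
      then have "q u = q v" using C_closed by (simp add: q_eq_iff)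
      then show "(u, v) \<in> point_kernel ?f" using C_closed[OF uv] by (simp add: point_kernel_def)
    qed
    then have "?f x = ?f y" by (rule *[rule_format, OF spectrum_Q_pullback[OF \<psi>]])
    then show "\<psi> (q x) = \<psi> (q y)" using xy by simp
  qed
  have "spatial_congruence \<kappa> L C \<longleftrightarrow>
    (\<forall>x\<in>carrier L. \<forall>y\<in>carrier L. (\<forall>\<psi>\<in>spectrum \<kappa> Q. \<psi> (q x) = \<psi> (q y)) \<longrightarrow> q x = q y)"
    unfolding spatial_congruence_def Q.spatial_iff_points_separate carrier_Q
    by (simp only: ball_simps)
  also have "\<dots> \<longleftrightarrow> (\<forall>x\<in>carrier L. \<forall>y\<in>carrier L.
      (\<forall>f\<in>spectrum \<kappa> L. C \<subseteq> point_kernel f \<longrightarrow> f x = f y) \<longrightarrow> (x, y) \<in> C)"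
    by (intro ball_cong HOL.refl arg_cong2[where f = "(\<longrightarrow>)"] points q_eq_iff)
  finally show ?thesis .
qed

theorem mainTheorem20:
  fixes \<kappa> :: "'k size_bound"
    and L :: "('a, 'c) gorder_scheme"
    and C :: "'a rel"
  assumes "regular_bound \<kappa>"
    and "kframe L \<kappa>"
    and "kframe_congruence \<kappa> L C"
  shows "spatial_congruence \<kappa> L C \<longleftrightarrow>
    (\<exists>\<P>. (\<forall>P \<in> \<P>. prime_element (congruence_frame \<kappa> L) P) \<and>
      C = (carrier L \<times> carrier L) \<inter> \<Inter>\<P>)"
proof -
  interpret kframe_with_congruence L \<kappa> C
    using assms by (intro kframe_with_congruence.intro regular_kframe.intro
        regular_kframe_axioms.intro kframe_with_congruence_axioms.intro)
  show ?thesis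
  proof
    assume spatial: "spatial_congruence \<kappa> L C"
    \<comment> \<open>If no point lies above \<open>C\<close>, the family is empty and \<open>C\<close> is the full relation.\<close>
    let ?\<P> = "point_kernel ` {f \<in> spectrum \<kappa> L. C \<subseteq> point_kernel f}"
    have "C = (carrier L \<times> carrier L) \<inter> \<Inter>?\<P>"
    proof
      show "C \<subseteq> (carrier L \<times> carrier L) \<inter> \<Inter>?\<P>" using C_closed by auto
      show "(carrier L \<times> carrier L) \<inter> \<Inter>?\<P> \<subseteq> C"
      proof clarify
        fix x y assume xy: "x \<in> carrier L" "y \<in> carrier L" "(x, y) \<in> \<Inter>?\<P>"
        have "f x = f y" if "f \<in> spectrum \<kappa> L" "C \<subseteq> point_kernel f" for f
        proof -
          have "(x, y) \<in> point_kernel f" using that xy(3) by blast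
          then show ?thesis by (simp add: point_kernel_def)
        qed
        then show "(x, y) \<in> C" using spatial xy(1,2) unfolding spatial_congruence_iff by blast
      qed
    qed
    moreover have "\<forall>P\<in>?\<P>. prime_element (congruence_frame \<kappa> L) P"
      using prime_point_kernel by blast
    ultimately show "\<exists>\<P>. (\<forall>P \<in> \<P>. prime_element (congruence_frame \<kappa> L) P) \<and>
        C = (carrier L \<times> carrier L) \<inter> \<Inter>\<P>" by blast
  next
    assume "\<exists>\<P>. (\<forall>P \<in> \<P>. prime_element (congruence_frame \<kappa> L) P) \<and>
      C = (carrier L \<times> carrier L) \<inter> \<Inter>\<P>"
    then obtain \<P> where prime: "\<And>P. P \<in> \<P> \<Longrightarrow> prime_element (congruence_frame \<kappa> L) P"
      and C: "C = (carrier L \<times> carrier L) \<inter> \<Inter>\<P>" by blast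
    show "spatial_congruence \<kappa> L C"
      unfolding spatial_congruence_iff
    proof (intro ballI impI)
      fix x y assume xy: "x \<in> carrier L" "y \<in> carrier L"
        and eq: "\<forall>f\<in>spectrum \<kappa> L. C \<subseteq> point_kernel f \<longrightarrow> f x = f y"
      have "(x, y) \<in> P" if P: "P \<in> \<P>" for P
      proof -
        obtain f where f: "f \<in> spectrum \<kappa> L" "P = point_kernel f"
          using prime_congruence_is_point_kernel[OF prime[OF P]] .
        moreover have "C \<subseteq> P" using C P by blast
        ultimately have "f x = f y" using eq by blast
        then show ?thesis using f xy by (simp add: point_kernel_def)
      qed
      with xy C show "(x, y) \<in> C" by blast
    qed
  qed
qed

end
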